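(* $$q(4)=2.$$
   Context: For $q>0$, a weak $\mathbb T_q$-representation of the rank-$2$ uniform matroid $U_{2,n}$ is a family of positive reals $(\rho_{ij})_{1\le i<j\le n}$ such that for all $1\le i<j<k<\ell\le n$ the three numbers $(\rho_{ij}\rho_{k\ell})^{1/q}$, $(\rho_{ik}\rho_{j\ell})^{1/q}$, $(\rho_{i\ell}\rho_{jk})^{1/q}$ are the side lengths of a (possibly degenerate) Euclidean triangle (each is at most the sum of the other two). It is identified with the quadratic form $\sum_{i<j}\rho_{ij}x_ix_j$. A quadratic form with nonnegative coefficients in $x_1,\dots,x_n$ is Lorentzian if it is a limit of quadratic forms with nonnegative coefficients whose Hessians have exactly one positive and $n-1$ negative eigenvalues (equivalently, its Hessian has at most one positive eigenvalue). $\mathrm{Gr}^{\mathrm w}_{U_{2,n}}(\mathbb T_q)$ is the set of weak $\mathbb T_q$-representations of $U_{2,n}$ modulo positive scaling, and $\mathbb P\mathrm L_{U_{2,n}}$ is the set of Lorentzian quadratic forms whose set of monomials with nonzero coefficient is exactly $\{x_ix_j:1\le i<j\le n\}$, modulo positive scaling. Define $$q(n):=\sup\{q>0 \mid \mathrm{Gr}^{\mathrm w}_{U_{2,n}}(\mathbb T_q)\subseteq\mathbb P\mathrm L_{U_{2,n}}\}.$$ *)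

theory Defs
  imports
    "Jordan_Normal_Form.Char_Poly"
    "HOL-Library.Extended_Real"
begin

section \<open>Quadratic forms\<close>

text \<open>
  A real quadratic form in \<open>x\<^sub>1, \<dots>, x\<^sub>n\<close> is given by its coefficient family: \<open>c i j\<close> is the
  coefficient of the monomial \<open>x\<^sub>i x\<^sub>j\<close> for \<open>1 \<le> i \<le> j \<le> n\<close>. All other values are required to be
  \<open>0\<close>, so that every quadratic form has exactly one representation.
\<close>

type_synonym qform = "nat \<Rightarrow> nat \<Rightarrow> real"

definition qforms :: "nat \<Rightarrow> qform set" where
  "qforms n = {c. \<forall>i j. c i j \<noteq> 0 \<longrightarrow> 1 \<le> i \<and> i \<le> j \<and> j \<le> n}"

definition qform_eval :: "nat \<Rightarrow> qform \<Rightarrow> (nat \<Rightarrow> real) \<Rightarrow> real" where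
  "qform_eval n c x = (\<Sum>i=1..n. \<Sum>j=i..n. c i j * x i * x j)"

definition nonneg_coeffs :: "qform \<Rightarrow> bool" where
  "nonneg_coeffs c \<longleftrightarrow> (\<forall>i j. 0 \<le> c i j)"

definition qform_support :: "qform \<Rightarrow> (nat \<times> nat) set" where
  "qform_support c = {(i, j). c i j \<noteq> 0}"

definition hessian_entry :: "qform \<Rightarrow> nat \<Rightarrow> nat \<Rightarrow> real" where
  "hessian_entry c i j = (if i = j then 2 * c i i else c (min i j) (max i j))"

text \<open>Matrix rows and columns are numbered from \<open>0\<close>, whence the shift by \<open>Suc\<close>.\<close>

definition hessian :: "nat \<Rightarrow> qform \<Rightarrow> real mat" where
  "hessian n c = mat n n (\<lambda>(i, j). hessian_entry c (Suc i) (Suc j))"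

text \<open>
  The next two lemmas show that \<open>hessian_entry c i j\<close> is the second partial derivative of the form.
\<close>

lemma first_partial_deriv_qform_eval:
  fixes x :: "nat \<Rightarrow> real"
  assumes "k \<in> {1..n}"
  shows "((\<lambda>t. qform_eval n c (x(k := t))) has_field_derivative
           (\<Sum>l=1..n. hessian_entry c k l * x l)) (at (x k))"
proof -
  let ?I = "{1..n}"
  let ?d = "\<lambda>i. if i = k then 1 else (0::real)"
  have coord: "((\<lambda>t. (x(k := t)) i) has_field_derivative ?d i) (at s)" for i s
    by (cases "i = k") auto
  have "((\<lambda>t. qform_eval n c (x(k := t))) has_field_derivative
      (\<Sum>i=1..n. \<Sum>j=i..n. c i j * (?d i * x j + x i * ?d j))) (at (x k))"
    unfolding qform_eval_def
    by (intro DERIV_sum) (rule derivative_eq_intros coord refl | simp add: algebra_simps)+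
  moreover have "(\<Sum>i=1..n. \<Sum>j=i..n. c i j * (?d i * x j + x i * ?d j))
      = (\<Sum>l=1..n. hessian_entry c k l * x l)"
  proof -
    have "(\<Sum>i=1..n. \<Sum>j=i..n. c i j * (?d i * x j + x i * ?d j))
        = (\<Sum>i\<in>?I. \<Sum>j\<in>?I. if i \<le> j then c i j * (?d i * x j + x i * ?d j) else 0)"
    proof (rule sum.cong[OF refl])
      fix i assume i: "i \<in> ?I"
      have "{i..n} = {j \<in> ?I. i \<le> j}" using i by auto
      then show "(\<Sum>j=i..n. c i j * (?d i * x j + x i * ?d j))
        = (\<Sum>j\<in>?I. if i \<le> j then c i j * (?d i * x j + x i * ?d j) else 0)"
        by (simp only: sum.inter_filter[symmetric] finite_atLeastAtMost)
    qed
    also have "\<dots> = (\<Sum>i\<in>?I. \<Sum>j\<in>?I. if i = k then (if k \<le> j then c k j * x j else 0) else 0)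
        + (\<Sum>i\<in>?I. \<Sum>j\<in>?I. if j = k then (if i \<le> k then c i k * x i else 0) else 0)"
      unfolding sum.distrib[symmetric] by (intro sum.cong refl) (auto simp: algebra_simps)
    also have "(\<Sum>i\<in>?I. \<Sum>j\<in>?I. if i = k then (if k \<le> j then c k j * x j else 0) else 0)
        = (\<Sum>j\<in>?I. if k \<le> j then c k j * x j else 0)"
      using assms by (subst sum.swap) (simp add: sum.delta)
    also have "(\<Sum>i\<in>?I. \<Sum>j\<in>?I. if j = k then (if i \<le> k then c i k * x i else 0) else 0)
        = (\<Sum>i\<in>?I. if i \<le> k then c i k * x i else 0)"
      using assms by (simp add: sum.delta)
    also have "(\<Sum>j\<in>?I. if k \<le> j then c k j * x j else 0) + (\<Sum>i\<in>?I. if i \<le> k then c i k * x i else 0)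
        = (\<Sum>l=1..n. hessian_entry c k l * x l)"
      unfolding sum.distrib[symmetric]
      by (intro sum.cong refl) (auto simp: hessian_entry_def min_def max_def)
    finally show ?thesis .
  qed
  ultimately show ?thesis by (simp only:)
qed

lemma second_partial_deriv_qform_eval:
  fixes x :: "nat \<Rightarrow> real"
  assumes "i \<in> {1..n}"
  shows "((\<lambda>t. \<Sum>l=1..n. hessian_entry c j l * (x(i := t)) l) has_field_derivative
           hessian_entry c i j) (at (x i))"
proof -
  let ?d = "\<lambda>l. if l = i then 1 else (0::real)"
  have coord: "((\<lambda>t. (x(i := t)) l) has_field_derivative ?d l) (at s)" for l s
    by (cases "l = i") auto
  have "((\<lambda>t. \<Sum>l=1..n. hessian_entry c j l * (x(i := t)) l) has_field_derivative
      (\<Sum>l=1..n. hessian_entry c j l * ?d l)) (at (x i))"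
    by (intro DERIV_sum DERIV_cmult coord)
  moreover have "(\<Sum>l=1..n. hessian_entry c j l * ?d l) = hessian_entry c j i"
    using assms by (simp add: if_distrib[of "\<lambda>z. _ * z"] sum.delta cong: if_cong)
  moreover have "hessian_entry c j i = hessian_entry c i j"
    by (auto simp: hessian_entry_def min.commute max.commute)
  ultimately show ?thesis by (simp only:)
qed


section \<open>Lorentzian quadratic forms\<close>

text \<open>Eigenvalues are counted with multiplicity.\<close>

definition num_pos_eigenvalues :: "real mat \<Rightarrow> nat" where
  "num_pos_eigenvalues A = size (filter_mset (\<lambda>e. 0 < e) (proots (char_poly A)))"

definition num_neg_eigenvalues :: "real mat \<Rightarrow> nat" where
  "num_neg_eigenvalues A = size (filter_mset (\<lambda>e. e < 0) (proots (char_poly A)))"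

definition strictly_lorentzian :: "nat \<Rightarrow> qform set" where
  "strictly_lorentzian n = {c \<in> qforms n. nonneg_coeffs c \<and>
     num_pos_eigenvalues (hessian n c) = 1 \<and> num_neg_eigenvalues (hessian n c) = n - 1}"

definition lorentzian :: "nat \<Rightarrow> qform set" where
  "lorentzian n = {c \<in> qforms n. nonneg_coeffs c \<and>
     (\<exists>C :: nat \<Rightarrow> qform. (\<forall>m. C m \<in> strictly_lorentzian n) \<and>
        (\<forall>i j. (\<lambda>m. C m i j) \<longlonglongrightarrow> c i j))}"


section \<open>Weak representations of the uniform matroid of rank 2\<close>

text \<open>Side lengths of a possibly degenerate Euclidean triangle.\<close>

definition triangle_sides :: "real \<Rightarrow> real \<Rightarrow> real \<Rightarrow> bool" where
  "triangle_sides a b c \<longleftrightarrow> a \<le> b + c \<and> b \<le> a + c \<and> c \<le> a + b"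

definition weak_rep :: "nat \<Rightarrow> real \<Rightarrow> (nat \<Rightarrow> nat \<Rightarrow> real) \<Rightarrow> bool" where
  "weak_rep n q \<rho> \<longleftrightarrow>
     (\<forall>i j. 1 \<le> i \<and> i < j \<and> j \<le> n \<longrightarrow> 0 < \<rho> i j) \<and>
     (\<forall>i j k l. 1 \<le> i \<and> i < j \<and> j < k \<and> k < l \<and> l \<le> n \<longrightarrow>
        triangle_sides ((\<rho> i j * \<rho> k l) powr (1 / q))
                       ((\<rho> i k * \<rho> j l) powr (1 / q))
                       ((\<rho> i l * \<rho> j k) powr (1 / q)))"

text \<open>The form \<open>\<Sum>\<^bsub>i<j\<^esub> \<rho>\<^bsub>ij\<^esub> x\<^sub>i x\<^sub>j\<close>.\<close>

definition form_of_rep :: "nat \<Rightarrow> (nat \<Rightarrow> nat \<Rightarrow> real) \<Rightarrow> qform" where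
  "form_of_rep n \<rho> = (\<lambda>i j. if 1 \<le> i \<and> i < j \<and> j \<le> n then \<rho> i j else 0)"


section \<open>Spaces modulo positive scaling\<close>

definition pos_scaling :: "(qform \<times> qform) set" where
  "pos_scaling = {(c, d). \<exists>t>0. d = (\<lambda>i j. t * c i j)}"

lemma equiv_pos_scaling: "equiv UNIV pos_scaling"
proof (rule equivI)
  show "refl pos_scaling"
    by (auto simp: refl_on_def pos_scaling_def intro: exI[of _ 1])
  show "sym pos_scaling"
  proof (rule symI)
    fix c d assume "(c, d) \<in> pos_scaling"
    then obtain t where "t > 0" "d = (\<lambda>i j. t * c i j)" by (auto simp: pos_scaling_def)
    then have "inverse t > 0" "c = (\<lambda>i j. inverse t * d i j)" by (auto simp: fun_eq_iff)
    then show "(d, c) \<in> pos_scaling" unfolding pos_scaling_def by blast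
  qed
  show "trans pos_scaling"
  proof (rule transI)
    fix c d e assume "(c, d) \<in> pos_scaling" "(d, e) \<in> pos_scaling"
    then obtain s t where "s > 0" "d = (\<lambda>i j. s * c i j)" "t > 0" "e = (\<lambda>i j. t * d i j)"
      by (auto simp: pos_scaling_def)
    then have "t * s > 0" "e = (\<lambda>i j. (t * s) * c i j)" by (auto simp: fun_eq_iff)
    then show "(c, e) \<in> pos_scaling" unfolding pos_scaling_def by blast
  qed
qed simp

definition Gr_w :: "nat \<Rightarrow> real \<Rightarrow> qform set set" where
  "Gr_w n q = (form_of_rep n ` {\<rho>. weak_rep n q \<rho>}) // pos_scaling"

definition PL :: "nat \<Rightarrow> qform set set" where
  "PL n = {c \<in> lorentzian n. qform_support c = {(i, j). 1 \<le> i \<and> i < j \<and> j \<le> n}} // pos_scaling"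

text \<open>The supremum may be infinite (e.g. for \<open>n = 3\<close>), so it is taken in the extended reals.\<close>

definition q_sup :: "nat \<Rightarrow> ereal" where
  "q_sup n = Sup (ereal ` {q. 0 < q \<and> Gr_w n q \<subseteq> PL n})"

end

theory Submission
  imports Defs
begin

text \<open>
  For \<open>n = 4\<close> everything depends on the three products \<open>X = \<rho>\<^sub>1\<^sub>2 \<rho>\<^sub>3\<^sub>4\<close>, \<open>Y = \<rho>\<^sub>1\<^sub>3 \<rho>\<^sub>2\<^sub>4\<close>,
  \<open>Z = \<rho>\<^sub>1\<^sub>4 \<rho>\<^sub>2\<^sub>3\<close>: the Hessian of \<open>\<Sum>\<^bsub>i<j\<^esub> \<rho>\<^bsub>ij\<^esub> x\<^sub>i x\<^sub>j\<close> has determinant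
  \<open>X\<^sup>2 + Y\<^sup>2 + Z\<^sup>2 - 2 (X Y + X Z + Y Z)\<close> (\<open>det_hessian_4\<close>). With \<open>X = x\<^sup>2\<close>, \<open>Y = y\<^sup>2\<close>, \<open>Z = z\<^sup>2\<close> this is
  \<open>- (x + y + z) (y + z - x) (x + z - y) (x + y - z)\<close>, by Heron's identity (\<open>heron\<close>), so for
  positive \<open>\<rho>\<close> it is nonpositive exactly when \<open>\<surd>X\<close>, \<open>\<surd>Y\<close>, \<open>\<surd>Z\<close> are the sides of a triangle,
  which is the condition on a weak representation for \<open>q = 2\<close>.

  The inclusion holds for \<open>q = 2\<close>. A symmetric \<open>4 \<times> 4\<close> matrix with zero diagonal, positive
  off-diagonal entries and negative determinant has one positive and three negative eigenvalues
  (\<open>signature_hollow_symmetric_4\<close>): its eigenvalues are real, their product is negative, their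
  sum is zero, and their third elementary symmetric function is positive, which rules out three
  positive eigenvalues. So strict triangles give strictly Lorentzian forms. A degenerate triangle
  becomes strict when the same \<open>\<epsilon> > 0\<close> is added to each side; hence every weak representation for
  \<open>q = 2\<close> gives a limit of strictly Lorentzian forms (\<open>lorentzian_form_of_rep\<close>).

  The inclusion fails for every \<open>q > 2\<close>. The determinant of the Hessian of a Lorentzian form in four
  variables is nonpositive, as a limit of products of one positive and three negative numbers
  (\<open>det_hessian_lorentzian\<close>). For \<open>\<rho>\<^sub>1\<^sub>2 = 2\<^sup>q\<close> and all other \<open>\<rho>\<^bsub>ij\<^esub> = 1\<close>, the
  triangle for \<open>q\<close> is the degenerate one with sides \<open>2, 1, 1\<close>, but the determinant is
  \<open>2\<^sup>q (2\<^sup>q - 4) > 0\<close> (\<open>not_Gr_w_4_subset_PL\<close>).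
\<close>

section \<open>Eigenvalues of real symmetric matrices\<close>

lemma monic_eq_prod_proots:
  fixes p :: "'a :: idom poly"
  assumes "lead_coeff p = 1" "size (proots p) = degree p"
  shows "p = (\<Prod>r\<in>#proots p. [:- r, 1:])"
proof -
  have "\<exists>q. p = (\<Prod>r\<in>#proots p. [:- r, 1:]) * q" if "p \<noteq> 0" for p :: "'a poly"
    using that
  proof (induction p rule: poly_root_order_induct)
    case (root p x n)
    then have p: "p \<noteq> 0" by auto
    with root obtain q where "p = (\<Prod>r\<in>#proots p. [:- r, 1:]) * q" by auto
    with p show ?case
      by (intro exI[of _ q]) (simp add: proots_mult proots_power repeat_mset_right mult.assoc)
  next
    case (no_roots p)
    then have "proots p = {#}" by (intro multiset_eqI) (auto simp: order_root)
    then show ?case by auto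
  qed auto
  moreover have p: "p \<noteq> 0" using assms(1) by auto
  ultimately obtain q where q: "p = (\<Prod>r\<in>#proots p. [:- r, 1:]) * q" (is "p = ?P * q") by blast
  have P: "lead_coeff (\<Prod>r\<in>#M. [:- r, 1:]) = 1 \<and> degree (\<Prod>r\<in>#M. [:- r, 1:]) = size M"
    for M :: "'a multiset"
  proof (induction M)
    case (add r M)
    then have "(\<Prod>r\<in>#M. [:- r, 1:]) \<noteq> 0" by auto
    then have "degree ([:- r, 1:] * (\<Prod>r\<in>#M. [:- r, 1:])) = Suc (size M)"
      using add by (subst degree_mult_eq) auto
    moreover have "lead_coeff ([:- r, 1:] * (\<Prod>r\<in>#M. [:- r, 1:])) = 1"
      using add by (subst lead_coeff_mult) auto
    ultimately show ?case by simp
  qed simp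
  have "degree p = degree ?P + degree q"
    using p q by (metis degree_mult_eq mult_zero_left mult_zero_right)
  then have "degree q = 0" using P[of "proots p"] assms(2) by simp
  then obtain a where a: "q = [:a:]" by (rule degree_eq_zeroE)
  have "lead_coeff p = lead_coeff ?P * lead_coeff q"
    using q by (metis lead_coeff_mult)
  then have "lead_coeff q = 1" using P[of "proots p"] assms(1) by (metis mult_1)
  then have "a = 1" using a by simp
  then show ?thesis using q a by simp
qed

lemma det_eq_prod_proots:
  fixes A :: "'a :: field mat"
  assumes A: "A \<in> carrier_mat n n" and "size (proots (char_poly A)) = n"
  shows "det A = prod_mset (proots (char_poly A))"
proof -
  let ?R = "proots (char_poly A)"
  have "char_poly A = (\<Prod>r\<in>#?R. [:- r, 1:])"
    using degree_monic_char_poly[OF A] assms(2) by (intro monic_eq_prod_proots) auto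
  then have "poly (char_poly A) 0 = poly (\<Prod>r\<in>#?R. [:- r, 1:]) 0" by simp
  also have "poly (\<Prod>r\<in>#M. [:- r, 1:]) 0 = (- 1) ^ size M * prod_mset M" for M :: "'a multiset"
    by (induction M) auto
  also have "poly (char_poly A) 0 = (- 1) ^ n * det A"
  proof -
    have "- char_matrix A 0 = (- 1) \<cdot>\<^sub>m A"
      using A by (intro eq_matI) (auto simp: char_matrix_def)
    then show ?thesis using A by (simp add: char_poly_matrix[OF A])
  qed
  finally show ?thesis using assms(2) by simp
qed

lemma eigenvalue_of_real_symmetric_mat_in_Reals:
  fixes A :: "real mat"
  assumes A: "A \<in> carrier_mat n n" and sym: "transpose_mat A = A"
    and ev: "eigenvalue (map_mat complex_of_real A) k"
  shows "k \<in> \<real>"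
proof -
  define B where "B = map_mat complex_of_real A"
  have B: "B \<in> carrier_mat n n" using A by (simp add: B_def)
  have BT: "transpose_mat B = B" using sym by (simp add: B_def map_mat_transpose)
  from ev obtain v where v: "v \<in> carrier_vec n" "v \<noteq> 0\<^sub>v n" "B *\<^sub>v v = k \<cdot>\<^sub>v v"
    using B unfolding eigenvalue_def eigenvector_def B_def[symmetric] by auto
  have w: "conjugate v \<in> carrier_vec n" using v by simp
  have "conjugate (B *\<^sub>v v) = B *\<^sub>v conjugate v"
  proof (rule eq_vecI)
    fix i assume i: "i < dim_vec (B *\<^sub>v conjugate v)"
    have "conjugate (row B i) = row B i"
      using i B A by (intro eq_vecI) (auto simp: B_def)
    then show "conjugate (B *\<^sub>v v) $ i = (B *\<^sub>v conjugate v) $ i"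
      using i B v(1) by (simp add: conjugate_sprod_vec[of _ n v] del: conjugate_complex_def)
  qed (use B in auto)
  then have Bw: "B *\<^sub>v conjugate v = conjugate k \<cdot>\<^sub>v conjugate v"
    using v by (simp add: conjugate_smult_vec)
  have "k * (v \<bullet>c v) = (transpose_mat B *\<^sub>v v) \<bullet>c v"
    using v w by (simp add: BT)
  also have "\<dots> = v \<bullet> (B *\<^sub>v conjugate v)"
    using transpose_vec_mult_scalar[OF B w v(1)] by simp
  also have "\<dots> = conjugate k * (v \<bullet>c v)"
    using v w by (simp add: Bw)
  finally have "k = conjugate k" using v conjugate_square_eq_0_vec[OF v(1)] by auto
  then show ?thesis by (simp add: Reals_cnj_iff)
qed

lemma size_proots_char_poly_symmetric:
  fixes A :: "real mat"
  assumes A: "A \<in> carrier_mat n n" and sym: "transpose_mat A = A"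
  shows "size (proots (char_poly A)) = n"
proof -
  let ?B = "map_mat complex_of_real A"
  have B: "?B \<in> carrier_mat n n" using A by simp
  obtain as where as: "char_poly ?B = (\<Prod>a\<leftarrow>as. [:- a, 1:])" "length as = n"
    using char_poly_factorized[OF B] by blast
  have real: "complex_of_real (Re a) = a" if "a \<in> set as" for a
  proof -
    have "poly (char_poly ?B) a = 0"
      using that unfolding as(1) by (induction as) auto
    then show ?thesis
      using eigenvalue_of_real_symmetric_mat_in_Reals[OF assms] eigenvalue_root_char_poly[OF B]
      by simp
  qed
  interpret H: map_poly_inj_idom_hom complex_of_real ..
  have "map_poly complex_of_real (\<Prod>a\<leftarrow>as. [:- Re a, 1:]) = (\<Prod>a\<leftarrow>as. [:- a, 1:])"
    using real by (induction as) (simp_all add: H.hom_mult del: mult_pCons_left)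
  also have "\<dots> = map_poly complex_of_real (char_poly A)"
    using as(1) of_real_hom.char_poly_hom[OF A] by metis
  finally have "char_poly A = (\<Prod>a\<leftarrow>as. [:- Re a, 1:])"
    by (simp add: H.eq_iff)
  moreover have "proots (\<Prod>a\<leftarrow>xs. [:- Re a, 1:]) = mset (map Re xs) \<and> (\<Prod>a\<leftarrow>xs. [:- Re a, 1:]) \<noteq> 0" for xs
    by (induction xs) (auto simp: proots_mult simp del: mult_pCons_left)
  ultimately show ?thesis using as(2) by simp
qed

section \<open>The signature of a symmetric 4 by 4 matrix with zero diagonal\<close>

text \<open>Laplace expansion along the first row, in a form that unfolds a determinant of given size.\<close>

lemma det_mat_Suc:
  fixes f :: "nat \<times> nat \<Rightarrow> 'a :: comm_ring_1"
  shows "det (mat (Suc n) (Suc n) f) = (\<Sum>j<Suc n. (- 1) ^ j * f (0, j) *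
    det (mat n n (\<lambda>(a, b). f (Suc a, if b < j then b else Suc b))))"
proof -
  have "mat_delete (mat (Suc n) (Suc n) f) 0 j = mat n n (\<lambda>(a, b). f (Suc a, if b < j then b else Suc b))" for j
    unfolding mat_delete_def by (intro eq_matI) auto
  then show ?thesis
    by (subst laplace_expansion_row[of _ "Suc n" 0]) (auto simp: cofactor_def mult_ac intro!: sum.cong)
qed

text \<open>
  The common diagonal entry \<open>t\<close> lets one formula serve for the Hessian (\<open>t = 0\<close>) and for its
  characteristic polynomial (\<open>t\<close> the indeterminate).
\<close>

lemma det_4_symmetric:
  fixes A :: "'a :: comm_ring_1 mat"
  assumes A: "A \<in> carrier_mat 4 4" and sym: "transpose_mat A = A"
    and diag: "\<And>i. i < 4 \<Longrightarrow> A $$ (i, i) = t"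
    and entries: "A $$ (0, 1) = a" "A $$ (0, 2) = b" "A $$ (0, 3) = c"
      "A $$ (1, 2) = d" "A $$ (1, 3) = e" "A $$ (2, 3) = g"
  shows "det A = t ^ 4 - (a\<^sup>2 + b\<^sup>2 + c\<^sup>2 + d\<^sup>2 + e\<^sup>2 + g\<^sup>2) * t\<^sup>2
    + 2 * (a * b * d + a * c * e + b * c * g + d * e * g) * t
    + ((a * g)\<^sup>2 + (b * e)\<^sup>2 + (c * d)\<^sup>2 - 2 * (a * g * (b * e) + a * g * (c * d) + b * e * (c * d)))"
proof -
  have swap: "A $$ (j, i) = A $$ (i, j)" if "i < 4" "j < 4" for i j
    using that A by (subst sym[symmetric]) simp
  have "A = mat 4 4 (\<lambda>ij. A $$ ij)" using A by (intro eq_matI) auto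
  also have "det \<dots> = det (mat (Suc (Suc (Suc (Suc 0)))) (Suc (Suc (Suc (Suc 0)))) (\<lambda>ij. A $$ ij))"
    by (simp add: eval_nat_numeral)
  also have "\<dots> = t ^ 4 - (a\<^sup>2 + b\<^sup>2 + c\<^sup>2 + d\<^sup>2 + e\<^sup>2 + g\<^sup>2) * t\<^sup>2
    + 2 * (a * b * d + a * c * e + b * c * g + d * e * g) * t
    + ((a * g)\<^sup>2 + (b * e)\<^sup>2 + (c * d)\<^sup>2 - 2 * (a * g * (b * e) + a * g * (c * d) + b * e * (c * d)))"
    using diag[of 0] diag[of 1] diag[of 2] diag[of 3] entries
      swap[of 0 1] swap[of 0 2] swap[of 0 3] swap[of 1 2] swap[of 1 3] swap[of 2 3]
    unfolding det_mat_Suc by (simp add: lessThan_Suc numeral_2_eq_2 numeral_3_eq_3 power4_eq_xxxx power2_eq_square algebra_simps)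
  finally show ?thesis .
qed

text \<open>
  If \<open>c\<close> and \<open>d\<close> were both positive, then \<open>a + b = - (c + d)\<close> would turn the second
  hypothesis into \<open>(c + d) (a b - c d) > 0\<close>, so \<open>a b > c d > 0\<close>, against the third.
\<close>

lemma second_largest_neg:
  fixes a b c d :: real
  assumes "a + b + c + d = 0" "a * b * c + a * b * d + a * c * d + b * c * d > 0"
    and "a * b * c * d < 0"
    and "a \<le> b" "b \<le> c" "c \<le> d"
  shows "c < 0" and "d > 0"
proof -
  show "c < 0"
  proof (rule ccontr)
    assume "\<not> c < 0"
    moreover have "c \<noteq> 0" "d \<noteq> 0" using assms(3) by auto
    ultimately have c: "c > 0" "d > 0" using assms(6) by auto
    have s: "a + b = - (c + d)" using assms(1) by linarith
    have "a * b * c + a * b * d + a * c * d + b * c * d = (c + d) * (a * b) + (a + b) * (c * d)"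
      by (simp add: algebra_simps)
    also have "\<dots> = (c + d) * (a * b - c * d)" unfolding s by (simp add: algebra_simps)
    finally have "a * b > c * d" using assms(2) c by (simp add: zero_less_mult_iff)
    moreover have "c * d > 0" using c by simp
    ultimately have "a * b * (c * d) > 0" by simp
    then show False using assms(3) by (simp add: mult.assoc)
  qed
  then show "d > 0" using assms by linarith
qed

lemma signature_hollow_symmetric_4:
  fixes A :: "real mat"
  assumes A: "A \<in> carrier_mat 4 4" and sym: "transpose_mat A = A"
    and diag: "\<And>i. i < 4 \<Longrightarrow> A $$ (i, i) = 0"
    and pos: "\<And>i j. i < j \<Longrightarrow> j < 4 \<Longrightarrow> A $$ (i, j) > 0"
    and det: "det A < 0"
  shows "num_pos_eigenvalues A = 1" and "num_neg_eigenvalues A = 3"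
proof -
  let ?R = "proots (char_poly A)"
  have R: "size ?R = 4" using size_proots_char_poly_symmetric[OF A sym] .
  \<comment> \<open>List the eigenvalues in increasing order.\<close>
  define xs where "xs = sorted_list_of_multiset ?R"
  have "length xs = 4" using R unfolding xs_def by (metis mset_sorted_list_of_multiset size_mset)
  then obtain a b c d where xs: "xs = [a, b, c, d]"
    by (auto simp: eval_nat_numeral length_Suc_conv)
  have "sorted xs" unfolding xs_def by simp
  then have ord: "a \<le> b" "b \<le> c" "c \<le> d" by (auto simp: xs)
  have eq: "?R = {#a, b, c, d#}"
    using mset_sorted_list_of_multiset[of ?R] xs_def xs by (metis mset.simps)
  have "char_poly A = (\<Prod>r\<in>#?R. [:- r, 1:])"
    using degree_monic_char_poly[OF A] R by (intro monic_eq_prod_proots) auto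
  then have split: "char_poly A = [:- a, 1:] * ([:- b, 1:] * ([:- c, 1:] * [:- d, 1:]))"
    by (simp add: eq mult_ac)
  \<comment> \<open>Compare the coefficients of \<open>t\<^sup>3\<close> and \<open>t\<close> in this product with those of \<open>det (t I - A)\<close>.\<close>
  let ?x = "\<lambda>i j. A $$ (i, j)"
  let ?C = "char_poly_matrix A"
  have C: "?C \<in> carrier_mat 4 4" using A by simp
  have ent: "?C $$ (i, j) = (if i = j then [:0, 1:] else [:- ?x i j:])" if "i < 4" "j < 4" for i j
    using that A diag by (auto simp: char_poly_matrix_def)
  have symC: "transpose_mat ?C = ?C"
  proof (rule eq_matI)
    fix i j assume "i < dim_row ?C" "j < dim_col ?C"
    then have ij: "i < 4" "j < 4" using C by auto
    have "?x j i = ?x i j" using ij A by (subst sym[symmetric]) simp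
    then show "transpose_mat ?C $$ (i, j) = ?C $$ (i, j)"
      using ij C by (simp add: ent)
  qed (use C in auto)
  define S where "S = ?x 0 1 * ?x 0 2 * ?x 1 2 + ?x 0 1 * ?x 0 3 * ?x 1 3
    + ?x 0 2 * ?x 0 3 * ?x 2 3 + ?x 1 2 * ?x 1 3 * ?x 2 3"
  have "S > 0"
    unfolding S_def by (intro add_pos_pos mult_pos_pos pos) auto
  have coeffs: "coeff (char_poly A) 3 = 0 \<and> coeff (char_poly A) 1 = - 2 * S"
    unfolding char_poly_def S_def
    by (subst (1 2) det_4_symmetric[OF C symC, of "[:0, 1:]" "[:- ?x 0 1:]" "[:- ?x 0 2:]" "[:- ?x 0 3:]"
        "[:- ?x 1 2:]" "[:- ?x 1 3:]" "[:- ?x 2 3:]"])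
      (simp_all add: ent power2_eq_square eval_nat_numeral numeral_poly)
  have "coeff (char_poly A) 3 = - (a + b + c + d)"
    "coeff (char_poly A) 1 = - (a * b * c + a * b * d + a * c * d + b * c * d)"
    unfolding split by (simp_all add: eval_nat_numeral algebra_simps)
  with coeffs \<open>S > 0\<close> have "a + b + c + d = 0" "a * b * c + a * b * d + a * c * d + b * c * d > 0"
    by simp_all
  moreover have prod: "a * b * c * d < 0"
    using det det_eq_prod_proots[OF A R] by (simp add: eq mult_ac)
  ultimately have "c < 0" "d > 0" using second_largest_neg ord by metis+
  then show "num_pos_eigenvalues A = 1" "num_neg_eigenvalues A = 3"
    using ord unfolding num_pos_eigenvalues_def num_neg_eigenvalues_def eq by auto
qed


section \<open>The determinant of the Hessian of a Lorentzian form\<close>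

lemma tendsto_det:
  fixes A :: "nat \<Rightarrow> 'a :: {comm_ring_1, real_normed_field} mat"
  assumes "\<And>m. A m \<in> carrier_mat n n" "B \<in> carrier_mat n n"
    and "\<And>i j. i < n \<Longrightarrow> j < n \<Longrightarrow> (\<lambda>m. A m $$ (i, j)) \<longlonglongrightarrow> B $$ (i, j)"
  shows "(\<lambda>m. det (A m)) \<longlonglongrightarrow> det B"
  unfolding det_def'[OF assms(1)] det_def'[OF assms(2)]
  by (intro tendsto_intros assms(3)) (auto simp: permutes_in_image[where S = "{0..<n}"] dest: permutes_in_image)

lemma hessian_carrier [simp]: "hessian n c \<in> carrier_mat n n"
  by (simp add: hessian_def)

lemma transpose_hessian: "transpose_mat (hessian n c) = hessian n c"
  by (intro eq_matI) (auto simp: hessian_def hessian_entry_def min.commute max.commute)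

lemma det_hessian_strictly_lorentzian:
  assumes "c \<in> strictly_lorentzian n"
  shows "0 < (- 1) ^ (n - 1) * det (hessian n c)"
proof -
  let ?A = "hessian n c"
  let ?R = "proots (char_poly ?A)"
  define P where "P = filter_mset (\<lambda>r. 0 < r) ?R"
  define N where "N = filter_mset (\<lambda>r. r < 0) ?R"
  define Z where "Z = filter_mset (\<lambda>r. r = 0) ?R"
  have R: "?R = P + N + Z"
    unfolding P_def N_def Z_def by (intro multiset_eqI) auto
  have sz: "size P = 1" "size N = n - 1"
    using assms by (auto simp: strictly_lorentzian_def num_pos_eigenvalues_def
        num_neg_eigenvalues_def P_def N_def)
  have "size ?R = n"
    using size_proots_char_poly_symmetric[OF hessian_carrier transpose_hessian] .
  with R sz have "Z = {#}" by (cases "n = 0") auto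
  with R have "det ?A = prod_mset P * prod_mset N"
    using det_eq_prod_proots[OF hessian_carrier \<open>size ?R = n\<close>] by simp
  moreover have "0 < prod_mset M" if "\<forall>r\<in>#M. 0 < r" for M :: "real multiset"
    using that by (induction M) auto
  then have "0 < prod_mset P" by (auto simp: P_def)
  moreover have "0 < (- 1) ^ size M * prod_mset M" if "\<forall>r\<in>#M. r < 0" for M :: "real multiset"
    using that by (induction M) (auto simp: mult_less_0_iff zero_less_mult_iff)
  then have "0 < (- 1) ^ size N * prod_mset N" by (auto simp: N_def)
  ultimately show ?thesis
    using mult_pos_pos[of "prod_mset P" "(- 1) ^ size N * prod_mset N"] sz by (simp add: mult_ac)
qed

lemma det_hessian_lorentzian:
  assumes "c \<in> lorentzian n"
  shows "0 \<le> (- 1) ^ (n - 1) * det (hessian n c)"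
proof -
  from assms obtain C where C: "\<And>m. C m \<in> strictly_lorentzian n" "\<And>i j. (\<lambda>m. C m i j) \<longlonglongrightarrow> c i j"
    by (auto simp: lorentzian_def)
  have "(\<lambda>m. det (hessian n (C m))) \<longlonglongrightarrow> det (hessian n c)"
    by (intro tendsto_det) (auto simp: hessian_def hessian_entry_def intro!: tendsto_intros C(2))
  then have "(\<lambda>m. (- 1) ^ (n - 1) * det (hessian n (C m))) \<longlonglongrightarrow> (- 1) ^ (n - 1) * det (hessian n c)"
    by (intro tendsto_intros)
  then show ?thesis
    using det_hessian_strictly_lorentzian[OF C(1)] by (intro LIMSEQ_le_const) (blast intro: less_imp_le)+
qed

section \<open>Forms in four variables\<close>

lemma det_hessian_4:
  fixes c :: qform
  assumes "\<And>i. c i i = 0"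
  shows "det (hessian 4 c) = (c 1 2 * c 3 4)\<^sup>2 + (c 1 3 * c 2 4)\<^sup>2 + (c 1 4 * c 2 3)\<^sup>2
    - 2 * (c 1 2 * c 3 4 * (c 1 3 * c 2 4) + c 1 2 * c 3 4 * (c 1 4 * c 2 3) + c 1 3 * c 2 4 * (c 1 4 * c 2 3))"
  by (subst det_4_symmetric[OF hessian_carrier transpose_hessian, where t = 0
      and a = "c 1 2" and b = "c 1 3" and c = "c 1 4" and d = "c 2 3" and e = "c 2 4" and g = "c 3 4"])
    (auto simp: hessian_def hessian_entry_def assms eval_nat_numeral)

lemma heron:
  fixes x y z :: "'a :: comm_ring_1"
  shows "(x\<^sup>2)\<^sup>2 + (y\<^sup>2)\<^sup>2 + (z\<^sup>2)\<^sup>2 - 2 * (x\<^sup>2 * y\<^sup>2 + x\<^sup>2 * z\<^sup>2 + y\<^sup>2 * z\<^sup>2)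
    = - ((x + y + z) * (y + z - x) * (x + z - y) * (x + y - z))"
  by (simp add: power2_eq_square algebra_simps)

lemma strictly_lorentzian_form_of_rep:
  assumes pos: "\<And>i j. 1 \<le> i \<Longrightarrow> i < j \<Longrightarrow> j \<le> 4 \<Longrightarrow> 0 < \<rho> i j"
    and sides: "\<rho> 1 2 * \<rho> 3 4 = x\<^sup>2" "\<rho> 1 3 * \<rho> 2 4 = y\<^sup>2" "\<rho> 1 4 * \<rho> 2 3 = z\<^sup>2"
    and tri: "0 < x" "0 < y" "0 < z" "x < y + z" "y < x + z" "z < x + y"
  shows "form_of_rep 4 \<rho> \<in> strictly_lorentzian 4"
proof -
  let ?c = "form_of_rep 4 \<rho>"
  have "det (hessian 4 ?c) = - ((x + y + z) * (y + z - x) * (x + z - y) * (x + y - z))"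
    using heron[of x y z] by (subst det_hessian_4) (simp_all add: form_of_rep_def sides del: One_nat_def)
  also have "\<dots> < 0" using tri by (simp add: mult_pos_pos)
  finally have det: "det (hessian 4 ?c) < 0" .
  have "hessian 4 ?c $$ (i, i) = 0" if "i < 4" for i
    using that by (simp add: hessian_def hessian_entry_def form_of_rep_def)
  moreover have "0 < hessian 4 ?c $$ (i, j)" if "i < j" "j < 4" for i j
    using that pos by (simp add: hessian_def hessian_entry_def form_of_rep_def)
  ultimately have "num_pos_eigenvalues (hessian 4 ?c) = 1" "num_neg_eigenvalues (hessian 4 ?c) = 3"
    using signature_hollow_symmetric_4[OF hessian_carrier transpose_hessian _ _ det] by blast+
  moreover have "?c \<in> qforms 4" "nonneg_coeffs ?c"
    using pos by (auto simp: qforms_def nonneg_coeffs_def form_of_rep_def less_imp_le)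
  ultimately show ?thesis by (simp add: strictly_lorentzian_def)
qed

lemma lorentzian_form_of_rep:
  assumes "weak_rep 4 2 \<rho>"
  shows "form_of_rep 4 \<rho> \<in> lorentzian 4"
proof -
  have pos: "0 < \<rho> i j" if "1 \<le> i" "i < j" "j \<le> 4" for i j
    using assms that by (simp add: weak_rep_def)
  define x where "x = sqrt (\<rho> 1 2 * \<rho> 3 4)"
  define y where "y = sqrt (\<rho> 1 3 * \<rho> 2 4)"
  define z where "z = sqrt (\<rho> 1 4 * \<rho> 2 3)"
  have xyz: "0 < x" "0 < y" "0 < z" by (simp_all add: x_def y_def z_def pos)
  have sq: "x\<^sup>2 = \<rho> 1 2 * \<rho> 3 4" "y\<^sup>2 = \<rho> 1 3 * \<rho> 2 4" "z\<^sup>2 = \<rho> 1 4 * \<rho> 2 3"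
    by (simp_all add: x_def y_def z_def pos less_imp_le)
  have "triangle_sides ((\<rho> 1 2 * \<rho> 3 4) powr (1 / 2)) ((\<rho> 1 3 * \<rho> 2 4) powr (1 / 2))
      ((\<rho> 1 4 * \<rho> 2 3) powr (1 / 2))"
    using assms unfolding weak_rep_def by auto
  then have tri: "x \<le> y + z" "y \<le> x + z" "z \<le> x + y"
    by (simp_all add: triangle_sides_def powr_half_sqrt x_def y_def z_def pos less_imp_le)
  \<comment> \<open>Changing only the entries \<open>12, 13, 14\<close> makes the three products \<open>(x + \<epsilon>)\<^sup>2\<close>, \<open>(y + \<epsilon>)\<^sup>2\<close>, \<open>(z + \<epsilon>)\<^sup>2\<close>.\<close>
  define \<sigma> where "\<sigma> \<epsilon> = (\<lambda>i j. if (i, j) = (1, 2) then (x + \<epsilon>)\<^sup>2 / \<rho> 3 4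
    else if (i, j) = (1, 3) then (y + \<epsilon>)\<^sup>2 / \<rho> 2 4
    else if (i, j) = (1, 4) then (z + \<epsilon>)\<^sup>2 / \<rho> 2 3 else \<rho> i j)" for \<epsilon> :: real
  have "form_of_rep 4 (\<sigma> \<epsilon>) \<in> strictly_lorentzian 4" if "\<epsilon> > 0" for \<epsilon>
  proof (rule strictly_lorentzian_form_of_rep)
    show "0 < \<sigma> \<epsilon> i j" if "1 \<le> i" "i < j" "j \<le> 4" for i j
      using that pos xyz \<open>\<epsilon> > 0\<close> by (auto simp: \<sigma>_def)
    show "\<sigma> \<epsilon> 1 2 * \<sigma> \<epsilon> 3 4 = (x + \<epsilon>)\<^sup>2" "\<sigma> \<epsilon> 1 3 * \<sigma> \<epsilon> 2 4 = (y + \<epsilon>)\<^sup>2"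
      "\<sigma> \<epsilon> 1 4 * \<sigma> \<epsilon> 2 3 = (z + \<epsilon>)\<^sup>2"
      using pos[of 3 4] pos[of 2 4] pos[of 2 3] by (simp_all add: \<sigma>_def)
  qed (use tri xyz that in auto)
  moreover have "(\<lambda>m. form_of_rep 4 (\<sigma> (inverse (real (Suc m)))) i j) \<longlonglongrightarrow> form_of_rep 4 \<rho> i j" for i j
  proof -
    have "(\<lambda>m. \<sigma> (e m) i j) \<longlonglongrightarrow> \<sigma> 0 i j" if "e \<longlonglongrightarrow> 0" for e
      using pos[of 3 4] pos[of 2 4] pos[of 2 3] that unfolding \<sigma>_def
      by (auto intro!: tendsto_eq_intros)
    from this[OF LIMSEQ_inverse_real_of_nat]
    have "(\<lambda>m. \<sigma> (inverse (real (Suc m))) i j) \<longlonglongrightarrow> \<sigma> 0 i j" .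
    moreover have "\<sigma> 0 i j = \<rho> i j"
      using pos[of 3 4] pos[of 2 4] pos[of 2 3] by (auto simp: \<sigma>_def sq)
    ultimately show ?thesis by (auto simp: form_of_rep_def)
  qed
  moreover have "form_of_rep 4 \<rho> \<in> qforms 4" "nonneg_coeffs (form_of_rep 4 \<rho>)"
    using pos by (auto simp: qforms_def nonneg_coeffs_def form_of_rep_def less_imp_le)
  ultimately show ?thesis
    unfolding lorentzian_def by (auto intro!: exI[of _ "\<lambda>m. form_of_rep 4 (\<sigma> (inverse (real (Suc m))))"])
qed

lemma Gr_w_4_2_subset_PL: "Gr_w 4 2 \<subseteq> PL 4"
proof
  fix K assume "K \<in> Gr_w 4 2"
  then obtain \<rho> where \<rho>: "weak_rep 4 2 \<rho>" "K = pos_scaling `` {form_of_rep 4 \<rho>}"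
    by (auto simp: Gr_w_def quotient_def)
  have "qform_support (form_of_rep 4 \<rho>) = {(i, j). 1 \<le> i \<and> i < j \<and> j \<le> 4}"
    using \<rho>(1) by (force simp: qform_support_def form_of_rep_def weak_rep_def)
  with \<rho> lorentzian_form_of_rep show "K \<in> PL 4"
    by (auto simp: PL_def intro!: quotientI)
qed

lemma not_Gr_w_4_subset_PL:
  assumes "2 < q"
  shows "\<not> Gr_w 4 q \<subseteq> PL 4"
proof
  assume sub: "Gr_w 4 q \<subseteq> PL 4"
  define \<rho> :: "nat \<Rightarrow> nat \<Rightarrow> real" where "\<rho> i j = (if (i, j) = (1, 2) then 2 powr q else 1)" for i j
  let ?f = "form_of_rep 4 \<rho>"
  have "triangle_sides ((\<rho> i j * \<rho> k l) powr (1 / q)) ((\<rho> i k * \<rho> j l) powr (1 / q)) ((\<rho> i l * \<rho> j k) powr (1 / q))"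
    if "1 \<le> i" "i < j" "j < k" "k < l" "l \<le> 4" for i j k l :: nat
  proof -
    have "i = 1 \<and> j = 2 \<and> k = 3 \<and> l = 4" using that by linarith
    then show ?thesis using assms by (simp add: \<rho>_def powr_powr triangle_sides_def)
  qed
  then have "weak_rep 4 q \<rho>" by (auto simp: weak_rep_def \<rho>_def)
  then have "pos_scaling `` {?f} \<in> PL 4"
    using sub by (auto simp: Gr_w_def intro: quotientI)
  then obtain c where c: "c \<in> lorentzian 4" "pos_scaling `` {?f} = pos_scaling `` {c}"
    by (auto simp: PL_def quotient_def)
  then have "(?f, c) \<in> pos_scaling" using equiv_pos_scaling by (simp add: eq_equiv_class_iff)
  then obtain t where t: "t > 0" "c = (\<lambda>i j. t * ?f i j)" by (auto simp: pos_scaling_def)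
  have "det (hessian 4 c) = t ^ 4 * (2 powr q * (2 powr q - 4))"
    by (subst det_hessian_4)
      (auto simp: t form_of_rep_def \<rho>_def power4_eq_xxxx power2_eq_square algebra_simps)
  moreover have "4 < 2 powr q" using powr_less_mono[of 2 q 2] assms by (simp add: powr_numeral)
  ultimately have "0 < det (hessian 4 c)" using t by simp
  then show False using det_hessian_lorentzian[OF c(1)] by simp
qed

theorem mainTheorem7:
  shows "q_sup 4 = 2"
proof (rule antisym)
  show "q_sup 4 \<le> 2"
    unfolding q_sup_def
  proof (rule Sup_least)
    fix s assume "s \<in> ereal ` {q. 0 < q \<and> Gr_w 4 q \<subseteq> PL 4}"
    then obtain q where "s = ereal q" "Gr_w 4 q \<subseteq> PL 4" by auto
    then show "s \<le> 2" using not_Gr_w_4_subset_PL[of q] by (cases "2 < q") auto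
  qed
  have "ereal 2 \<in> ereal ` {q. 0 < q \<and> Gr_w 4 q \<subseteq> PL 4}"
    using Gr_w_4_2_subset_PL by simp
  then show "2 \<le> q_sup 4" unfolding q_sup_def by (metis Sup_upper numeral_eq_ereal)
qed

end
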